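(* Let $\mathcal{P} = \{p_1, \ldots, p_s\}$ be a finite set of $s \geq 1$ distinct points in the complex projective plane $\mathbb{P}^{2}$. Assume that the Seshadri constant of $\mathcal{O}_{\mathbb{P}^{2}}(1)$ centered at $\mathcal{P}$ is computed by an irreducible and reduced curve having multiplicity greater than $1$ at each point $p_{i} \in \mathcal{P}$. Then $$\varepsilon(\mathbb{P}^{2}, \mathcal{O}_{\mathbb{P}^{2}}(1); \mathcal{P}) > \sqrt{\frac{1}{2s}}.$$
   Context: We work over the complex numbers. For a finite set of points $\mathcal{P}=\{p_1,\dots,p_s\}\subset\mathbb{P}^2$, the multi-point Seshadri constant is $$\varepsilon(\mathbb{P}^{2}, \mathcal{O}_{\mathbb{P}^{2}}(1); \mathcal{P}) = \inf_{C \cap \mathcal{P} \neq \emptyset} \frac{\deg C}{\sum_{i=1}^{s} \mathrm{mult}_{p_{i}} C},$$ where the infimum is over all irreducible and reduced curves $C \subset \mathbb{P}^2$ passing through at least one point of $\mathcal{P}$. The Seshadri constant is said to be computed by a curve $C$ if the infimum is attained by $C$, i.e. $\varepsilon(\mathbb{P}^{2}, \mathcal{O}_{\mathbb{P}^{2}}(1); \mathcal{P}) = \deg C / \sum_{i=1}^{s} \mathrm{mult}_{p_{i}} C$. *)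

theory Defs
  imports
    "HOL-Analysis.Finite_Cartesian_Product"
    "HOL-Computational_Algebra.Polynomial_Factorial"
begin

text \<open>The complex projective plane: nonzero vectors of \<open>\<complex>\<^sup>3\<close> up to nonzero scalars.
  The coordinates of \<open>v\<close> are \<open>v $ 1\<close>, \<open>v $ 2\<close>, \<open>v $ 3\<close>.\<close>

definition proportional :: "complex ^ 3 \<Rightarrow> complex ^ 3 \<Rightarrow> bool" where
  "proportional v w \<longleftrightarrow> v \<noteq> 0 \<and> w \<noteq> 0 \<and> (\<exists>c. c \<noteq> 0 \<and> w = c *s v)"

quotient_type proj_plane = "complex ^ 3" / partial: proportional
proof (rule part_equivpI)
  have "proportional 1 1"
    unfolding proportional_def by (auto intro!: exI[of _ 1] simp: vec_eq_iff)
  then show "\<exists>v. proportional v v" ..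
  show "symp proportional"
  proof (rule sympI)
    fix v w assume "proportional v w"
    then obtain c where "v \<noteq> 0" "w \<noteq> 0" "c \<noteq> 0" "w = c *s v"
      unfolding proportional_def by blast
    then have "v = inverse c *s w" by (simp add: vec_eq_iff)
    with \<open>v \<noteq> 0\<close> \<open>w \<noteq> 0\<close> \<open>c \<noteq> 0\<close> show "proportional w v"
      unfolding proportional_def by (auto intro!: exI[of _ "inverse c"])
  qed
  show "transp proportional"
  proof (rule transpI)
    fix u v w assume "proportional u v" "proportional v w"
    then obtain c d where "u \<noteq> 0" "w \<noteq> 0" "c \<noteq> 0" "d \<noteq> 0" "v = c *s u" "w = d *s v"
      unfolding proportional_def by blast
    then show "proportional u w"
      unfolding proportional_def by (auto intro!: exI[of _ "d * c"] simp: vec_eq_iff)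
  qed
qed

text \<open>\<open>p\<close> lies in the standard affine chart where the \<open>i\<close>-th coordinate does not vanish.\<close>

lift_definition in_chart :: "3 \<Rightarrow> proj_plane \<Rightarrow> bool" is "\<lambda>i v. v $ i \<noteq> 0"
  by (auto simp: proportional_def)

text \<open>The representative of \<open>p\<close> whose \<open>i\<close>-th coordinate is 1; meaningful only if
  \<open>in_chart i p\<close>.\<close>

lift_definition affine_rep :: "3 \<Rightarrow> proj_plane \<Rightarrow> complex ^ 3"
  is "\<lambda>i v. inverse (v $ i) *s v"
  by (auto simp: proportional_def vec_eq_iff)

text \<open>Polynomials in three variables are modelled as iterated univariate polynomials,
  the outermost variable being the third one.\<close>

type_synonym poly3 = "complex poly poly poly"

definition coeff3 :: "poly3 \<Rightarrow> nat \<Rightarrow> nat \<Rightarrow> nat \<Rightarrow> complex" where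
  "coeff3 F i j k = coeff (coeff (coeff F k) j) i"

text \<open>Substitution of ring elements \<open>x 1\<close>, \<open>x 2\<close>, \<open>x 3\<close> for the variables, where \<open>h\<close> embeds
  the complex numbers into the ring.\<close>

definition subst3 :: "(complex \<Rightarrow> 'a::comm_ring_1) \<Rightarrow> poly3 \<Rightarrow> (3 \<Rightarrow> 'a) \<Rightarrow> 'a" where
  "subst3 h F x =
     poly (map_poly (\<lambda>g. poly (map_poly (\<lambda>f. poly (map_poly h f) (x 1)) g) (x 2)) F) (x 3)"

definition total_degree :: "poly3 \<Rightarrow> nat" where
  "total_degree F = Max {i + j + k | i j k. coeff3 F i j k \<noteq> 0}"

definition homogeneous :: "poly3 \<Rightarrow> bool" where
  "homogeneous F \<longleftrightarrow> (\<forall>i j k. coeff3 F i j k \<noteq> 0 \<longrightarrow> i + j + k = total_degree F)"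

text \<open>An irreducible and reduced plane curve is given by an irreducible form, unique up to a
  nonzero scalar, and its degree is the degree of the form. Nonzero constants are units, so
  irreducible forms have positive degree.\<close>

definition integral_curve :: "poly3 \<Rightarrow> bool" where
  "integral_curve F \<longleftrightarrow> homogeneous F \<and> irreducible F"

definition on_curve :: "proj_plane \<Rightarrow> poly3 \<Rightarrow> bool" where
  "on_curve p F \<longleftrightarrow> (\<forall>v. v \<noteq> 0 \<and> abs_proj_plane v = p \<longrightarrow> subst3 id F (($) v) = 0)"

text \<open>The dehomogenisation of \<open>F\<close> in the \<open>i\<close>-th chart, in affine coordinates centred at \<open>p\<close>:
  the \<open>i\<close>-th variable is set to 1 and the two others are translated. Index arithmetic in the
  type \<open>3\<close> is modulo 3, so \<open>i + 1\<close> and \<open>i + 2\<close> are the two indices different from \<open>i\<close>.\<close>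

definition local_equation :: "3 \<Rightarrow> poly3 \<Rightarrow> proj_plane \<Rightarrow> complex poly poly" where
  "local_equation i F p = subst3 (\<lambda>c. [:[:c:]:]) F
     (\<lambda>j. [:[:affine_rep i p $ j:]:] +
       (if j = i + 1 then [:[:0, 1:]:] else if j = i + 2 then [:0, 1:] else 0))"

text \<open>The degree of the lowest nonzero homogeneous part, for a nonzero polynomial.\<close>

definition order_at_origin :: "complex poly poly \<Rightarrow> nat" where
  "order_at_origin f = (LEAST n. \<exists>i j. i + j = n \<and> coeff (coeff f j) i \<noteq> 0)"

text \<open>The multiplicity does not depend on the chart containing \<open>p\<close>.\<close>

definition mult_at :: "proj_plane \<Rightarrow> poly3 \<Rightarrow> nat" where
  "mult_at p F = order_at_origin (local_equation (SOME i. in_chart i p) F p)"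

definition seshadri_quotient :: "proj_plane set \<Rightarrow> poly3 \<Rightarrow> real" where
  "seshadri_quotient P F = real (total_degree F) / real (\<Sum>p\<in>P. mult_at p F)"

definition curves_meeting :: "proj_plane set \<Rightarrow> poly3 set" where
  "curves_meeting P = {F. integral_curve F \<and> (\<exists>p\<in>P. on_curve p F)}"

definition seshadri :: "proj_plane set \<Rightarrow> real" where
  "seshadri P = (INF F\<in>curves_meeting P. seshadri_quotient P F)"

definition computes_seshadri :: "poly3 \<Rightarrow> proj_plane set \<Rightarrow> bool" where
  "computes_seshadri F P \<longleftrightarrow> F \<in> curves_meeting P \<and> seshadri P = seshadri_quotient P F"

end

theory Submission
  imports Defs "HOL-Computational_Algebra.Field_as_Ring" "HOL-Analysis.Cartesian_Space" "HOL-Analysis.Convex"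
begin

text \<open>Let \<open>C\<close> be an irreducible curve of degree \<open>d\<close> that computes the Seshadri constant of \<open>s\<close>
  points, with multiplicity \<open>m\<^sub>p \<ge> 2\<close> at each of them. The constant equals \<open>d / (\<Sum>m\<^sub>p)\<close>, so the
  claim is \<open>(\<Sum>m\<^sub>p)\<^sup>2 < 2 s d\<^sup>2\<close>. The Cauchy-Schwarz inequality gives \<open>(\<Sum>m\<^sub>p)\<^sup>2 \<le> s \<Sum>m\<^sub>p\<^sup>2\<close>, and
  \<open>m\<^sub>p \<ge> 2\<close> gives \<open>m\<^sub>p\<^sup>2 \<le> 2 m\<^sub>p (m\<^sub>p - 1)\<close>. It remains to know that
  \<open>\<Sum>m\<^sub>p (m\<^sub>p - 1) \<le> d (d - 1) < d\<^sup>2\<close> (lemma \<open>sum_mult_pred_le\<close>), which is the Bezout inequality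
  for \<open>C\<close> and a polar curve: a nonzero partial derivative of the equation has degree \<open>d - 1\<close>,
  hence is no multiple of the equation, and has order at least \<open>m\<^sub>p - 1\<close> at \<open>p\<close>.

  The Bezout inequality \<open>\<Sum>m\<^sub>p n\<^sub>p \<le> d e\<close> for an irreducible form \<open>F\<close> of degree \<open>d\<close> and a form \<open>G\<close>
  of degree \<open>e\<close> that \<open>F\<close> does not divide (theorem \<open>sum_mult_le_prod_degrees\<close>) is proved by
  counting the unknowns and equations of one homogeneous linear system, with neither resultants
  nor intersection multiplicities. For large \<open>N\<close> the unknowns are a form \<open>A\<close> of degree \<open>N + e\<close>, a
  form \<open>B\<close> of degree \<open>N + d\<close>, and a coefficient for each jet of order less than \<open>m\<^sub>p + n\<^sub>p\<close> at
  each \<open>p\<close>. Each such jet is realised by a form of degree \<open>N + d + e\<close>, and \<open>S\<close> denotes the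
  combination of these forms with the unknown coefficients. The equations are
  \<open>A F + B G = S\<close>, the vanishing of \<open>A\<close> to order \<open>n\<^sub>p\<close> and of \<open>B\<close> to order \<open>m\<^sub>p\<close> at \<open>p\<close>, and a normalisation
  that excludes the syzygies \<open>A = G C\<close>, \<open>B = - F C\<close>. In a solution \<open>S\<close> vanishes to order
  \<open>m\<^sub>p + n\<^sub>p\<close> at every \<open>p\<close>, so \<open>S = 0\<close> because jets at distinct points are independent; then the
  solution is a syzygy, and the normalisation makes it zero. A system with only the zero solution
  has at least as many equations as unknowns, and the difference of the two numbers is
  \<open>d e - \<Sum>m\<^sub>p n\<^sub>p\<close>.\<close>

section \<open>Homogeneous linear systems\<close>


text \<open>Gaussian elimination: if some unknown \<open>x0\<close> occurs in the equation \<open>y\<close>, that equation expresses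
  \<open>x0\<close> through the others, which leaves a system with one unknown and one equation less.\<close>

lemma underdetermined_system:
  fixes a :: "'x \<Rightarrow> 'y \<Rightarrow> 'a::field"
  assumes "finite Y" "finite X" "card Y < card X"
  shows "\<exists>c. (\<exists>x\<in>X. c x \<noteq> 0) \<and> (\<forall>y\<in>Y. (\<Sum>x\<in>X. c x * a x y) = 0)"
  using assms
proof (induction Y arbitrary: X a rule: finite_induct)
  case empty
  then have "X \<noteq> {}" by auto
  then show ?case by (intro exI[of _ "\<lambda>_. 1"]) auto
next
  case (insert y Y)
  show ?case
  proof (cases "\<forall>x\<in>X. a x y = 0")
    case True
    have "card Y < card X" using insert by simp
    from insert.IH[OF insert.prems(1) this, of a] True show ?thesis by (auto intro: sum.neutral)
  next
    case False
    then obtain x0 where x0: "x0 \<in> X" "a x0 y \<noteq> 0" by blast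
    define r where "r x = a x y / a x0 y" for x
    have "card Y < card (X - {x0})" using insert x0 by simp
    from insert.IH[OF _ this, of "\<lambda>x z. a x z - r x * a x0 z"] insert.prems(1)
    obtain c x1 where c: "x1 \<in> X - {x0}" "c x1 \<noteq> 0"
      "\<And>z. z \<in> Y \<Longrightarrow> (\<Sum>x\<in>X-{x0}. c x * (a x z - r x * a x0 z)) = 0" by auto
    define c' where "c' x = (if x = x0 then - (\<Sum>x\<in>X-{x0}. c x * r x) else c x)" for x
    have S: "(\<Sum>x\<in>X. c' x * a x z) = (\<Sum>x\<in>X-{x0}. c x * (a x z - r x * a x0 z))" for z
    proof -
      have "(\<Sum>x\<in>X. c' x * a x z) = c' x0 * a x0 z + (\<Sum>x\<in>X-{x0}. c' x * a x z)"
        using x0 insert.prems(1) by (simp add: sum.remove)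
      also have "(\<Sum>x\<in>X-{x0}. c' x * a x z) = (\<Sum>x\<in>X-{x0}. c x * a x z)"
        by (rule sum.cong) (auto simp: c'_def)
      also have "c' x0 * a x0 z = - (\<Sum>x\<in>X-{x0}. c x * r x * a x0 z)"
        by (simp add: c'_def sum_distrib_right)
      finally show ?thesis
        by (simp add: sum_subtractf algebra_simps)
    qed
    have "(\<Sum>x\<in>X. c' x * a x y) = 0"
      unfolding S using x0 by (intro sum.neutral) (auto simp: r_def)
    with c S show ?thesis by (intro exI[of _ c']) (auto simp: c'_def intro!: bexI[of _ x1])
  qed
qed

section \<open>Substitution is a ring homomorphism\<close>

definition unital_hom :: "('a::comm_ring_1 \<Rightarrow> 'b::comm_ring_1) \<Rightarrow> bool" where
  "unital_hom h \<longleftrightarrow> h 1 = 1 \<and> (\<forall>a b. h (a + b) = h a + h b) \<and> (\<forall>a b. h (a * b) = h a * h b)"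

lemma unital_hom_0: "unital_hom h \<Longrightarrow> h 0 = 0"
  unfolding unital_hom_def by (metis add_cancel_right_right)

lemma poly_map_poly_pCons:
  assumes "h 0 = 0"
  shows "poly (map_poly h (pCons a f)) y = h a + y * poly (map_poly h f) y"
  using assms by (cases "pCons a f = 0") (auto simp: map_poly_pCons)

text \<open>Substitution in three variables is evaluation at one variable, iterated; so this step, from the
  coefficient ring to its polynomial ring, is all that is needed.\<close>

lemma unital_hom_eval:
  assumes h: "unital_hom h"
  shows "unital_hom (\<lambda>f. poly (map_poly h f) y)"
proof -
  note h0 = unital_hom_0[OF h]
  note pC = poly_map_poly_pCons[of h, OF h0]
  have add: "poly (map_poly h (f + g)) y = poly (map_poly h f) y + poly (map_poly h g) y" for f g
    by (induction f g rule: poly_induct2) (use h in \<open>auto simp: pC unital_hom_def algebra_simps\<close>)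
  have smult: "poly (map_poly h (smult a g)) y = h a * poly (map_poly h g) y" for a g
    by (induction g) (use h in \<open>auto simp: pC unital_hom_def algebra_simps\<close>)
  have "poly (map_poly h (f * g)) y = poly (map_poly h f) y * poly (map_poly h g) y" for f g
    by (induction f) (auto simp: pC add smult h0 algebra_simps)
  moreover have "poly (map_poly h 1) y = 1"
    using h by (simp add: unital_hom_def h0 map_poly_1)
  ultimately show ?thesis using add by (auto simp: unital_hom_def)
qed

lemma unital_hom_subst3:
  "unital_hom h \<Longrightarrow> unital_hom (\<lambda>F. subst3 h F x)"
  unfolding subst3_def by (intro unital_hom_eval)

lemma unital_hom_const: "unital_hom (\<lambda>c::complex. [:[:c:]:])"
  by (simp add: unital_hom_def one_pCons)

definition var3 :: "3 \<Rightarrow> poly3" where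
  "var3 j = (if j = 1 then [:[:[:0, 1:]:]:] else if j = 2 then [:[:0, 1:]:] else [:0, 1:])"

definition const3 :: "complex \<Rightarrow> poly3" where
  "const3 c = [:[:[:c:]:]:]"

lemma subst3_var3:
  assumes "unital_hom h"
  shows "subst3 h (var3 j) x = x j"
  using exhaust_3[of j] assms
  by (auto simp: var3_def subst3_def map_poly_pCons unital_hom_0 unital_hom_def map_poly_1)

lemma subst3_const3:
  assumes "unital_hom h"
  shows "subst3 h (const3 c) x = h c"
  using assms by (simp add: const3_def subst3_def poly_map_poly_pCons unital_hom_0)

section \<open>Local equations at a point\<close>

text \<open>The chart in which \<open>mult_at\<close> reads off the multiplicity.\<close>

definition chart :: "proj_plane \<Rightarrow> 3" where
  "chart p = (SOME i. in_chart i p)"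

definition germ :: "proj_plane \<Rightarrow> poly3 \<Rightarrow> complex poly poly" where
  "germ p F = local_equation (chart p) F p"

lemma unital_hom_germ: "unital_hom (germ p)"
  unfolding germ_def local_equation_def by (intro unital_hom_subst3 unital_hom_const)

lemma germ_add: "germ p (F + G) = germ p F + germ p G"
  and germ_mult: "germ p (F * G) = germ p F * germ p G"
  and germ_1: "germ p 1 = 1"
  and germ_0: "germ p 0 = 0"
  using unital_hom_germ[of p] unital_hom_0[of "germ p"] by (auto simp: unital_hom_def)

lemma germ_sum: "germ p (sum f A) = (\<Sum>a\<in>A. germ p (f a))"
  by (induction A rule: infinite_finite_induct) (auto simp: germ_add germ_0)

lemma germ_prod: "germ p (prod f A) = (\<Prod>a\<in>A. germ p (f a))"
  by (induction A rule: infinite_finite_induct) (auto simp: germ_mult germ_1)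

lemma germ_power: "germ p (F ^ n) = germ p F ^ n"
  by (induction n) (auto simp: germ_mult germ_1)

lemma germ_const3: "germ p (const3 c) = [:[:c:]:]"
  unfolding germ_def local_equation_def by (rule subst3_const3[OF unital_hom_const])

lemma germ_diff: "germ p (F - G) = germ p F - germ p G"
  using germ_add[of p "F - G" G] by simp

definition rep :: "proj_plane \<Rightarrow> complex ^ 3" where
  "rep p = affine_rep (chart p) p"

lemma germ_var3: "germ p (var3 j) = [:[:rep p $ j:]:] +
       (if j = chart p + 1 then [:[:0, 1:]:] else if j = chart p + 2 then [:0, 1:] else 0)"
  unfolding germ_def local_equation_def rep_def by (subst subst3_var3[OF unital_hom_const]) simp

lemma in_chart_chart: "in_chart (chart p) p"
proof -
  have "\<exists>i. in_chart i p"
    by transfer (auto simp: proportional_def vec_eq_iff)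
  then show ?thesis unfolding chart_def by (rule someI_ex)
qed

lemma rep_chart: "rep p $ chart p = 1"
proof -
  have "in_chart i p \<Longrightarrow> affine_rep i p $ i = 1" for i
    by transfer auto
  then show ?thesis using in_chart_chart by (simp add: rep_def)
qed

text \<open>The representatives of \<open>p\<close> and \<open>q\<close> may be normalised in different charts, so equal points need not
  have equal representatives a priori; proportionality is the right comparison.\<close>

lemma rep_proportional_imp_eq:
  assumes "rep p = c *s rep q"
  shows "p = q"
proof -
  have *: "in_chart i p \<Longrightarrow> in_chart j q \<Longrightarrow> affine_rep i p = c *s affine_rep j q \<Longrightarrow> p = q" for i j
  proof transfer
    fix i j :: 3 and c :: complex and v w :: "complex ^ 3"
    assume a: "proportional v v" "proportional w w" "v $ i \<noteq> 0" "w $ j \<noteq> 0"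
      and e: "inverse (v $ i) *s v = c *s (inverse (w $ j) *s w)"
    have v: "v = ((v $ i) * c * inverse (w $ j)) *s w"
    proof -
      have "v = (v $ i) *s (inverse (v $ i) *s v)" using a by (simp add: vec_eq_iff)
      also have "\<dots> = ((v $ i) * c * inverse (w $ j)) *s w" unfolding e by (simp add: vec_eq_iff)
      finally show ?thesis .
    qed
    define t where "t = (v $ i) * c * inverse (w $ j)"
    have vt: "v = t *s w" using v t_def by simp
    have "t \<noteq> 0" using a vt by (auto simp: proportional_def)
    then have "w = inverse t *s v" using vt by (simp add: vec_eq_iff)
    with a \<open>t \<noteq> 0\<close> show "proportional v w" by (auto simp: proportional_def intro!: exI[of _ "inverse t"])
  qed
  show ?thesis using *[OF in_chart_chart in_chart_chart] assms unfolding rep_def by blast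
qed

lemma chart_neq: "(i::3) + 1 \<noteq> i" "i + 2 \<noteq> i" "i + 1 \<noteq> i + 2"
  using exhaust_3[of i] by auto

lemma germ_var3_chart: "germ p (var3 (chart p)) = 1"
  using chart_neq[of "chart p"] by (auto simp: germ_var3 rep_chart one_pCons)

section \<open>Order of vanishing at the origin\<close>

text \<open>A condition instead of a number: the zero polynomial vanishes to every order, and linear
  combinations need no case distinction.\<close>

definition vanishes :: "nat \<Rightarrow> complex poly poly \<Rightarrow> bool" where
  "vanishes m f \<longleftrightarrow> (\<forall>i j. i + j < m \<longrightarrow> coeff (coeff f j) i = 0)"

lemma coeff2_mult:
  "coeff (coeff (f * g) j) i =
     (\<Sum>(b, a)\<in>{..j} \<times> {..i}. coeff (coeff f b) a * coeff (coeff g (j - b)) (i - a))"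
  by (simp add: coeff_mult coeff_sum sum.cartesian_product)

lemma vanishes_0: "vanishes m 0"
  by (simp add: vanishes_def)

lemma vanishes_add: "vanishes m f \<Longrightarrow> vanishes m g \<Longrightarrow> vanishes m (f + g)"
  by (simp add: vanishes_def)

lemma vanishes_diff: "vanishes m f \<Longrightarrow> vanishes m g \<Longrightarrow> vanishes m (f - g)"
  by (simp add: vanishes_def)

lemma vanishes_sum: "(\<And>a. a \<in> A \<Longrightarrow> vanishes m (f a)) \<Longrightarrow> vanishes m (sum f A)"
  by (induction A rule: infinite_finite_induct) (auto intro: vanishes_0 vanishes_add)

lemma vanishes_mono: "vanishes m f \<Longrightarrow> k \<le> m \<Longrightarrow> vanishes k f"
  by (simp add: vanishes_def)

lemma vanishes_mult:
  assumes "vanishes m f" "vanishes n g"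
  shows "vanishes (m + n) (f * g)"
  unfolding vanishes_def
proof (intro allI impI)
  fix i j :: nat assume ij: "i + j < m + n"
  have "coeff (coeff f b) a * coeff (coeff g (j - b)) (i - a) = 0" if "b \<le> j" "a \<le> i" for a b
  proof (cases "a + b < m")
    case False
    then have "(i - a) + (j - b) < n" using ij that by linarith
    then show ?thesis using assms(2) by (simp add: vanishes_def)
  qed (use assms(1) in \<open>simp add: vanishes_def\<close>)
  then show "coeff (coeff (f * g) j) i = 0"
    unfolding coeff2_mult by (intro sum.neutral) auto
qed

lemma vanishes_mult_left: "vanishes m g \<Longrightarrow> vanishes m (f * g)"
  using vanishes_mult[of 0 f m g] by (simp add: vanishes_def)

lemma vanishes_power: "vanishes 1 f \<Longrightarrow> vanishes n (f ^ n)"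
proof (induction n)
  case (Suc n)
  then show ?case using vanishes_mult[of 1 f n "f ^ n"] by simp
qed (simp add: vanishes_def)

text \<open>A power series \<open>u\<close> with nonzero constant term is a unit, but the argument stays inside the
  polynomial ring: at the lowest degree, the coefficients of \<open>u f\<close> are those of \<open>f\<close> times the constant
  term of \<open>u\<close>.\<close>

lemma vanishes_mult_unit_cancel:
  assumes "vanishes m (u * f)" "coeff (coeff u 0) 0 \<noteq> 0"
  shows "vanishes m f"
proof -
  have "i + j < m \<longrightarrow> coeff (coeff f j) i = 0" for i j
  proof (induction "i + j" arbitrary: i j rule: less_induct)
    case less
    show ?case
    proof
      assume ij: "i + j < m"
      have "0 = coeff (coeff (u * f) j) i" using assms(1) ij by (simp add: vanishes_def)
      also have "\<dots> = (\<Sum>(b, a)\<in>{..j} \<times> {..i}. coeff (coeff u b) a * coeff (coeff f (j - b)) (i - a))"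
        by (rule coeff2_mult)
      also have "\<dots> = (\<Sum>(b, a)\<in>{(0, 0)}. coeff (coeff u b) a * coeff (coeff f (j - b)) (i - a))"
      proof (rule sum.mono_neutral_right)
        have *: "coeff (coeff f (j - b)) (i - a) = 0" if "b \<le> j" "a \<le> i" "(b, a) \<noteq> (0, 0)" for a b
        proof -
          have "(i - a) + (j - b) < i + j" using that by (cases "b = 0") auto
          then show ?thesis using less[of "i - a" "j - b"] ij by simp
        qed
        show "\<forall>x\<in>{..j} \<times> {..i} - {(0, 0)}.
            (case x of (b, a) \<Rightarrow> coeff (coeff u b) a * coeff (coeff f (j - b)) (i - a)) = 0"
        proof
          fix x assume x: "x \<in> {..j} \<times> {..i} - {(0, 0)}"
          obtain b a where ba: "x = (b, a)" by (cases x)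
          show "(case x of (b, a) \<Rightarrow> coeff (coeff u b) a * coeff (coeff f (j - b)) (i - a)) = 0"
            using x *[of b a] unfolding ba by simp
        qed
      qed auto
      finally show "coeff (coeff f j) i = 0" using assms(2) by simp
    qed
  qed
  then show ?thesis by (simp add: vanishes_def)
qed

lemma vanishes_order_at_origin: "vanishes (order_at_origin f) f"
  unfolding vanishes_def order_at_origin_def by (metis (mono_tags, lifting) not_less_Least)

lemma vanishes_mult_at: "vanishes (mult_at p F) (germ p F)"
  using vanishes_order_at_origin[of "germ p F"] by (simp add: mult_at_def germ_def chart_def)

section \<open>Ternary forms\<close>

text \<open>Unlike \<open>homogeneous\<close>, this makes the degree a parameter, so that the forms of degree \<open>n\<close>
  together with zero are a vector space.\<close>

definition form :: "nat \<Rightarrow> poly3 \<Rightarrow> bool" where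
  "form n F \<longleftrightarrow> (\<forall>i j k. coeff3 F i j k \<noteq> 0 \<longrightarrow> i + j + k = n)"

definition mon3 :: "nat \<Rightarrow> nat \<Rightarrow> nat \<Rightarrow> poly3" where
  "mon3 i j k = monom (monom (monom 1 i) j) k"

lemma poly3_eqI: "(\<And>i j k. coeff3 F i j k = coeff3 G i j k) \<Longrightarrow> F = G"
  unfolding coeff3_def by (intro poly_eqI) auto

lemma coeff3_add: "coeff3 (F + G) i j k = coeff3 F i j k + coeff3 G i j k"
  and coeff3_diff: "coeff3 (F - G) i j k = coeff3 F i j k - coeff3 G i j k"
  and coeff3_0: "coeff3 0 i j k = 0"
  and coeff3_const3_mult: "coeff3 (const3 c * F) i j k = c * coeff3 F i j k"
  by (simp_all add: coeff3_def const3_def)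

lemma coeff3_sum: "coeff3 (sum f A) i j k = (\<Sum>a\<in>A. coeff3 (f a) i j k)"
  by (simp add: coeff3_def coeff_sum)

lemma coeff3_mon3: "coeff3 (mon3 i j k) i' j' k' = (if i' = i \<and> j' = j \<and> k' = k then 1 else 0)"
  by (auto simp: coeff3_def mon3_def)

lemma form_0: "form n 0"
  by (simp add: form_def coeff3_0)

lemma form_add: "form n F \<Longrightarrow> form n G \<Longrightarrow> form n (F + G)"
  unfolding form_def coeff3_add by (metis add.right_neutral)

lemma form_diff: "form n F \<Longrightarrow> form n G \<Longrightarrow> form n (F - G)"
  unfolding form_def coeff3_diff by (metis diff_self)

lemma form_sum: "(\<And>a. a \<in> A \<Longrightarrow> form n (f a)) \<Longrightarrow> form n (sum f A)"
  by (induction A rule: infinite_finite_induct) (auto intro: form_0 form_add)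

lemma form_mult:
  assumes "form m F" "form n G"
  shows "form (m + n) (F * G)"
  unfolding form_def
proof (intro allI impI)
  fix i j k assume "coeff3 (F * G) i j k \<noteq> 0"
  then have "(\<Sum>c\<le>k. \<Sum>b\<le>j. \<Sum>a\<le>i. coeff3 F a b c * coeff3 G (i - a) (j - b) (k - c)) \<noteq> 0"
    by (simp add: coeff3_def coeff_mult coeff_sum)
  then obtain c where "c \<le> k"
      "(\<Sum>b\<le>j. \<Sum>a\<le>i. coeff3 F a b c * coeff3 G (i - a) (j - b) (k - c)) \<noteq> 0"
    by (metis (no_types, lifting) atMost_iff sum.neutral)
  moreover from this obtain b where "b \<le> j"
      "(\<Sum>a\<le>i. coeff3 F a b c * coeff3 G (i - a) (j - b) (k - c)) \<noteq> 0"
    by (metis (no_types, lifting) atMost_iff sum.neutral)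
  moreover from this obtain a where "a \<le> i" "coeff3 F a b c * coeff3 G (i - a) (j - b) (k - c) \<noteq> 0"
    by (metis (no_types, lifting) atMost_iff sum.neutral)
  ultimately have "coeff3 F a b c \<noteq> 0" "coeff3 G (i - a) (j - b) (k - c) \<noteq> 0"
    and le: "a \<le> i" "b \<le> j" "c \<le> k"
    by auto
  then have "a + b + c = m" "(i - a) + (j - b) + (k - c) = n"
    using assms unfolding form_def by metis+
  with le show "i + j + k = m + n" by linarith
qed

lemma form_const3: "form 0 (const3 c)"
  by (auto simp: form_def coeff3_def const3_def coeff_pCons split: nat.splits)

lemma form_const3_mult: "form n F \<Longrightarrow> form n (const3 c * F)"
  using form_mult[OF form_const3] by fastforce

lemma form_1: "form 0 1"
  using form_const3[of 1] by (simp add: const3_def one_pCons)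

lemma form_power: "form m F \<Longrightarrow> form (m * n) (F ^ n)"
  by (induction n) (auto intro: form_mult form_1)

lemma form_prod: "(\<And>a. a \<in> A \<Longrightarrow> form m (f a)) \<Longrightarrow> form (m * card A) (prod f A)"
  by (induction A rule: infinite_finite_induct) (auto intro: form_mult form_1)

lemma form_var3: "form 1 (var3 j)"
  by (auto simp: form_def coeff3_def var3_def coeff_pCons split: nat.splits if_splits)

lemma form_mon3: "form (i + j + k) (mon3 i j k)"
  by (auto simp: form_def coeff3_mon3)

text \<open>The exponent of the leading monomial in the lexicographic order in which the third variable is
  the largest and the first one the smallest. Its multiplicativity controls the multiples of a
  form without Groebner bases or quotient spaces.\<close>

definition lead_exp :: "poly3 \<Rightarrow> nat \<times> nat \<times> nat" where
  "lead_exp F = (degree (lead_coeff (lead_coeff F)), degree (lead_coeff F), degree F)"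

lemma lead_exp_form:
  assumes "form n F" "F \<noteq> 0" "lead_exp F = (i, j, k)"
  shows "coeff3 F i j k \<noteq> 0" "i + j + k = n"
proof -
  show "coeff3 F i j k \<noteq> 0" using assms(2,3) by (auto simp: lead_exp_def coeff3_def)
  then show "i + j + k = n" using assms(1) by (simp add: form_def)
qed

lemma lead_exp_mult:
  assumes "F \<noteq> 0" "G \<noteq> 0" "lead_exp F = (i, j, k)" "lead_exp G = (i', j', k')"
  shows "lead_exp (F * G) = (i + i', j + j', k + k')"
  using assms by (auto simp: lead_exp_def lead_coeff_mult degree_mult_eq coeff_mult_degree_sum)

section \<open>Forms with prescribed jets at finitely many points\<close>

text \<open>Not all \<open>2 \<times> 2\<close> minors of the coordinates of \<open>p\<close> and \<open>q\<close> vanish, and since the chart coordinate of \<open>q\<close>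
  is 1, some minor that involves this coordinate does not vanish.\<close>

lemma separating_line:
  assumes "p \<noteq> q"
  shows "\<exists>L. form 1 L \<and> vanishes 1 (germ q L) \<and> coeff (coeff (germ p L) 0) 0 \<noteq> 0"
proof -
  obtain j where j: "rep p $ j \<noteq> rep p $ chart q * rep q $ j"
    using rep_proportional_imp_eq[of p "rep p $ chart q" q] assms by (auto simp: vec_eq_iff)
  define L where "L = var3 j - const3 (rep q $ j) * var3 (chart q)"
  have "vanishes 1 (germ q L)"
    by (auto simp: L_def germ_diff germ_mult germ_const3 germ_var3_chart vanishes_def)
      (auto simp: germ_var3)
  moreover have "coeff (coeff (germ p L) 0) 0 \<noteq> 0"
    using j by (auto simp: L_def germ_diff germ_mult germ_const3 germ_var3 algebra_simps)
  moreover have "form 1 L"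
    unfolding L_def by (intro form_diff form_var3 form_const3_mult)
  ultimately show ?thesis by blast
qed

lemma coeff2_0_mult: "coeff (coeff (f * g) 0) 0 = coeff (coeff f 0) 0 * coeff (coeff g 0) (0::nat)"
  by (simp add: coeff_mult)

text \<open>The product of the \<open>M\<close>-th powers of lines through the other points that avoid \<open>p\<close>.\<close>

lemma separating_form:
  assumes "finite P" "p \<in> P"
  shows "\<exists>H. form (M * (card P - 1)) H \<and> coeff (coeff (germ p H) 0) 0 \<noteq> 0 \<and>
           (\<forall>q\<in>P - {p}. vanishes M (germ q H))"
proof -
  have "\<forall>q\<in>P-{p}. \<exists>L. form 1 L \<and> vanishes 1 (germ q L) \<and> coeff (coeff (germ p L) 0) 0 \<noteq> 0"
    by (intro ballI separating_line) auto
  then obtain L where L: "\<And>q. q \<in> P - {p} \<Longrightarrow>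
      form 1 (L q) \<and> vanishes 1 (germ q (L q)) \<and> coeff (coeff (germ p (L q)) 0) 0 \<noteq> 0"
    by metis
  define H where "H = (\<Prod>q\<in>P-{p}. L q ^ M)"
  have fin: "finite (P - {p})" using assms by simp
  have "form (M * card (P - {p})) H"
    unfolding H_def using L form_power[of 1 _ M] by (intro form_prod) auto
  moreover have "card (P - {p}) = card P - 1" using assms by simp
  moreover have "coeff (coeff (germ p H) 0) 0 \<noteq> 0"
  proof -
    have pow: "coeff (coeff (f ^ n) 0) 0 = coeff (coeff f 0) 0 ^ n" for f :: "complex poly poly" and n
      by (induction n) (auto simp: coeff2_0_mult)
    have "coeff (coeff (prod g A) 0) 0 = (\<Prod>a\<in>A. coeff (coeff (g a) 0) 0)"
      for g :: "proj_plane \<Rightarrow> complex poly poly" and A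
      by (induction A rule: infinite_finite_induct) (auto simp: coeff2_0_mult)
    then show ?thesis using L fin by (simp add: H_def germ_prod germ_power pow)
  qed
  moreover have "vanishes M (germ q H)" if q: "q \<in> P - {p}" for q
  proof -
    have "H = (\<Prod>q\<in>P-{p}-{q}. L q ^ M) * L q ^ M"
      unfolding H_def using q fin by (subst prod.remove[of _ q]) (auto simp: mult_ac)
    then show ?thesis
      using L[OF q] by (simp add: germ_mult germ_power vanishes_mult_left vanishes_power)
  qed
  ultimately show ?thesis by metis
qed

text \<open>Every monomial in the affine coordinates centred at \<open>p\<close> is, up to a common factor that is a unit
  at \<open>p\<close>, the local equation of a form that is negligible at the other points. Multiplying the
  separating form by linear forms gives these monomials, and powers of the chart
  coordinate, whose local equation is 1, adjust the degree.\<close>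

lemma jet_forms:
  assumes "finite P" "p \<in> P" "M * card P \<le> n"
  shows "\<exists>E u. coeff (coeff u 0) 0 \<noteq> 0 \<and> (\<forall>i j. i + j < M \<longrightarrow>
           form n (E i j) \<and> germ p (E i j) = u * monom (monom 1 i) j \<and>
           (\<forall>q\<in>P - {p}. vanishes M (germ q (E i j))))"
proof -
  obtain H where H: "form (M * (card P - 1)) H" "coeff (coeff (germ p H) 0) 0 \<noteq> 0"
      "\<And>q. q \<in> P - {p} \<Longrightarrow> vanishes M (germ q H)"
    using separating_form[OF assms(1,2), of M] by blast
  define c where "c = chart p"
  define lin where "lin j = var3 j - const3 (rep p $ j) * var3 c" for j
  define E where "E i j = lin (c + 1) ^ i * lin (c + 2) ^ j *
      var3 c ^ (n - M * (card P - 1) - (i + j)) * H" for i j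
  have lin: "germ p (lin (c + 1)) = [:[:0, 1:]:]" "germ p (lin (c + 2)) = [:0, 1:]"
    unfolding lin_def c_def germ_diff germ_mult germ_const3 germ_var3_chart
    using chart_neq[of c] by (simp_all add: germ_var3 c_def)
  have lform: "form 1 (lin j)" for j
    unfolding lin_def by (intro form_diff form_var3 form_const3_mult)
  have "card P \<ge> 1" using assms by (metis One_nat_def Suc_leI card_gt_0_iff empty_iff)
  then have cM: "M * card P = M * (card P - 1) + M" by (cases "card P") auto
  have "form n (E i j) \<and> germ p (E i j) = germ p H * monom (monom 1 i) j \<and>
        (\<forall>q\<in>P - {p}. vanishes M (germ q (E i j)))" if ij: "i + j < M" for i j
  proof (intro conjI ballI)
    have "form (1 * i + 1 * j + 1 * (n - M * (card P - 1) - (i + j)) + M * (card P - 1)) (E i j)"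
      unfolding E_def by (intro form_mult form_power lform form_var3 H)
    moreover have "1 * i + 1 * j + 1 * (n - M * (card P - 1) - (i + j)) + M * (card P - 1) = n"
      using ij assms(3) cM by simp
    ultimately show "form n (E i j)" by simp
    have "[:[:0, 1:]:] ^ i * [:0, 1:] ^ j = (monom (monom 1 i) j :: complex poly poly)"
      by (simp add: monom_altdef poly_const_pow)
    then show "germ p (E i j) = germ p H * monom (monom 1 i) j"
      using germ_var3_chart[of p] by (simp add: E_def germ_mult germ_power lin c_def[symmetric] mult_ac)
    fix q assume "q \<in> P - {p}"
    then show "vanishes M (germ q (E i j))"
      unfolding E_def germ_mult[of q _ H] by (intro vanishes_mult_left H)
  qed
  then show ?thesis using H(2) by blast
qed

definition triangle :: "nat \<Rightarrow> (nat \<times> nat) set" where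
  "triangle m = {(i, j). i + j < m}"

lemma finite_triangle: "finite (triangle m)"
  by (rule finite_subset[of _ "{..m} \<times> {..m}"]) (auto simp: triangle_def)

text \<open>The forms belonging to the other points do not contribute at \<open>q\<close> below the order \<open>M\<close>, and the unit
  common to the forms that belong to \<open>q\<close> can be cancelled; what is left is a polynomial
  of degree less than \<open>r q\<close> that vanishes to order \<open>r q\<close>.\<close>

lemma jet_forms_independent:
  assumes "finite P"
    and E: "\<And>p i j. p \<in> P \<Longrightarrow> i + j < M \<Longrightarrow> germ p (E p i j) = u p * monom (monom 1 i) j"
      "\<And>p q i j. p \<in> P \<Longrightarrow> q \<in> P \<Longrightarrow> q \<noteq> p \<Longrightarrow> i + j < M \<Longrightarrow> vanishes M (germ q (E p i j))"
    and u: "\<And>p. p \<in> P \<Longrightarrow> coeff (coeff (u p) 0) 0 \<noteq> 0"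
    and r: "\<And>p. p \<in> P \<Longrightarrow> r p \<le> M"
    and v: "\<And>q. q \<in> P \<Longrightarrow> vanishes (r q)
       (germ q (\<Sum>(p, i, j)\<in>(SIGMA p:P. triangle (r p)). const3 (c p i j) * E p i j))"
    and q: "q \<in> P" "i + j < r q"
  shows "c q i j = 0"
proof -
  define S where "S p = (\<Sum>(i, j)\<in>triangle (r p). const3 (c p i j) * E p i j)" for p
  define f where "f = (\<Sum>(i, j)\<in>triangle (r q). monom (monom (c q i j) i) j)"
  have "(\<Sum>(p, i, j)\<in>(SIGMA p:P. triangle (r p)). const3 (c p i j) * E p i j) = (\<Sum>p\<in>P. S p)"
    unfolding S_def using assms(1) finite_triangle by (subst sum.Sigma) (auto intro!: sum.cong)
  also have "\<dots> = S q + (\<Sum>p\<in>P-{q}. S p)" using q assms(1) by (simp add: sum.remove)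
  finally have "vanishes (r q) (germ q (S q) + (\<Sum>p\<in>P-{q}. germ q (S p)))"
    using v[OF q(1)] by (simp add: germ_add germ_sum)
  moreover have "vanishes (r q) (\<Sum>p\<in>P-{q}. germ q (S p))"
  proof (rule vanishes_sum)
    fix p assume p: "p \<in> P - {q}"
    have "vanishes (r q) (germ q (const3 (c p i j) * E p i j))" if "(i, j) \<in> triangle (r p)" for i j
      unfolding germ_mult using that p q r[of p] r[of q]
      by (intro vanishes_mult_left vanishes_mono[OF E(2)]) (auto simp: triangle_def)
    then show "vanishes (r q) (germ q (S p))"
      unfolding S_def germ_sum by (intro vanishes_sum) auto
  qed
  ultimately have "vanishes (r q) (germ q (S q))"
    by (metis add_diff_cancel_right' vanishes_diff)
  moreover have "germ q (S q) = u q * f"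
    unfolding S_def f_def germ_sum sum_distrib_left
  proof (intro sum.cong refl, clarify)
    fix i j assume "(i, j) \<in> triangle (r q)"
    then have "i + j < M" using r[OF q(1)] by (simp add: triangle_def)
    then show "germ q (const3 (c q i j) * E q i j) = u q * monom (monom (c q i j) i) j"
      using q by (simp add: germ_mult germ_const3 E smult_monom mult.commute flip: mult_smult_right)
  qed
  ultimately have "vanishes (r q) f" using vanishes_mult_unit_cancel u[OF q(1)] by metis
  then have "0 = coeff (coeff f j) i" using q by (simp add: vanishes_def)
  also have "\<dots> = (\<Sum>x\<in>triangle (r q). if x = (i, j) then c q i j else 0)"
    unfolding f_def coeff_sum by (intro sum.cong) (auto split: if_splits)
  also have "\<dots> = c q i j"
    using q by (subst sum.delta[OF finite_triangle]) (simp add: triangle_def)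
  finally show ?thesis by simp
qed

section \<open>The Bezout inequality\<close>

text \<open>This identity does the numerical work of the Bezout inequality: the number of conditions for
  order \<open>m + n\<close> exceeds those for order \<open>m\<close> and for order \<open>n\<close> together by exactly \<open>m n\<close>, and the same
  identity for dimensions of spaces of forms produces \<open>d e\<close>.\<close>

lemma card_triangle_add: "card (triangle (a + b)) = card (triangle a) + card (triangle b) + a * b"
proof -
  have Suc: "card (triangle (Suc m)) = card (triangle m) + Suc m" for m
  proof -
    have "triangle (Suc m) = triangle m \<union> (\<lambda>i. (i, m - i)) ` {..m}"
      by (auto simp: triangle_def image_iff)
    moreover have "card ((\<lambda>i. (i, m - i)) ` {..m}) = Suc m"
      by (subst card_image) (auto intro: inj_onI)
    moreover have "triangle m \<inter> (\<lambda>i. (i, m - i)) ` {..m} = {}"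
      by (auto simp: triangle_def)
    ultimately show ?thesis by (simp add: card_Un_disjoint finite_triangle)
  qed
  have "triangle 0 = {}" by (simp add: triangle_def)
  then show ?thesis by (induction b) (simp_all add: Suc)
qed

definition exponents :: "nat \<Rightarrow> (nat \<times> nat \<times> nat) set" where
  "exponents n = {(i, j, k). i + j + k = n}"

lemma bij_exponents: "bij_betw (\<lambda>(i, j). (i, j, n - (i + j))) (triangle (Suc n)) (exponents n)"
  by (rule bij_betwI[where g = "\<lambda>(i, j, k). (i, j)"]) (auto simp: triangle_def exponents_def)

lemma card_exponents: "card (exponents n) = card (triangle (Suc n))"
  and finite_exponents: "finite (exponents n)"
  using bij_betw_same_card[OF bij_exponents] bij_betw_finite[OF bij_exponents] finite_triangle by auto

lemma coeff3_linear_combination: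
  "coeff3 (\<Sum>x\<in>X. const3 (c x) * f x) i j k = (\<Sum>x\<in>X. c x * coeff3 (f x) i j k)"
  by (simp add: coeff3_sum coeff3_const3_mult)

lemma coeff_germ_linear_combination:
  "coeff (coeff (germ p (\<Sum>x\<in>X. const3 (c x) * f x)) j) i =
     (\<Sum>x\<in>X. c x * coeff (coeff (germ p (f x)) j) i)"
  by (simp add: germ_sum germ_mult germ_const3 coeff_sum)

text \<open>The three summands index the coefficients of \<open>A\<close>, the coefficients of \<open>B\<close>, and the jets.\<close>

type_synonym bezout_unknown = "(nat \<times> nat \<times> nat) + (nat \<times> nat \<times> nat) + (proj_plane \<times> nat \<times> nat)"

text \<open>The Bezout inequality. The normalisation of \<open>B\<close> requires that its coefficients at the products of the
  leading monomial of \<open>F\<close> with the monomials of degree \<open>N\<close> vanish; a nonzero multiple of \<open>F\<close>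
  violates it at its own leading monomial. In this way the syzygies are excluded
  by exactly as many equations as they have parameters.\<close>

theorem sum_mult_le_prod_degrees:
  assumes fin: "finite P" and F: "irreducible F" "form d F"
    and G: "form e G" "\<not> F dvd G"
    and m: "\<And>p. p \<in> P \<Longrightarrow> vanishes (m p) (germ p F)"
    and n: "\<And>p. p \<in> P \<Longrightarrow> vanishes (n p) (germ p G)"
  shows "(\<Sum>p\<in>P. m p * n p) \<le> d * e"
proof (rule ccontr)
  assume large: "\<not> (\<Sum>p\<in>P. m p * n p) \<le> d * e"
  have F0: "F \<noteq> 0" using F by auto
  define r where "r p = m p + n p" for p
  define M where "M = (\<Sum>p\<in>P. r p)"
  have rM: "r p \<le> M" if "p \<in> P" for p
    unfolding M_def using that fin by (intro member_le_sum) auto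
  \<comment> \<open>degree \<open>N\<close> is enough to separate all jets of order less than \<open>M\<close>\<close>
  define N where "N = M * card P"
  define t where "t = N + d + e"
  have "\<forall>p\<in>P. \<exists>E u. coeff (coeff u 0) 0 \<noteq> 0 \<and> (\<forall>i j. i + j < M \<longrightarrow>
           form t (E i j) \<and> germ p (E i j) = u * monom (monom 1 i) j \<and>
           (\<forall>q\<in>P - {p}. vanishes M (germ q (E i j))))"
    using fin by (intro ballI jet_forms) (auto simp: t_def N_def)
  then obtain E u where
      u: "\<And>p. p \<in> P \<Longrightarrow> coeff (coeff (u p) 0) 0 \<noteq> 0"
    and E: "\<And>p i j. p \<in> P \<Longrightarrow> i + j < M \<Longrightarrow> form t (E p i j)"
      "\<And>p i j. p \<in> P \<Longrightarrow> i + j < M \<Longrightarrow> germ p (E p i j) = u p * monom (monom 1 i) j"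
      "\<And>p q i j. p \<in> P \<Longrightarrow> q \<in> P \<Longrightarrow> q \<noteq> p \<Longrightarrow> i + j < M \<Longrightarrow> vanishes M (germ q (E p i j))"
    unfolding bchoice_iff by (elim exE) blast
  define J where "J = (SIGMA p:P. triangle (r p))"
  define X :: "bezout_unknown set" where "X = exponents (N + e) <+> (exponents (N + d) <+> J)"
  define Y where "Y = exponents t <+> (exponents N <+>
      ((SIGMA p:P. triangle (n p)) <+> (SIGMA p:P. triangle (m p))))"
  obtain i0 j0 k0 where lead: "lead_exp F = (i0, j0, k0)" by (cases "lead_exp F")
  \<comment> \<open>the forms with which an unknown enters \<open>A\<close>, \<open>B\<close> and \<open>S\<close>\<close>
  define A' where "A' x = (case x of Inl (i, j, k) \<Rightarrow> mon3 i j k | Inr _ \<Rightarrow> 0)" for x :: bezout_unknown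
  define B' where "B' x = (case x of Inr (Inl (i, j, k)) \<Rightarrow> mon3 i j k | _ \<Rightarrow> 0)" for x :: bezout_unknown
  define E' where "E' x = (case x of Inr (Inr (p, i, j)) \<Rightarrow> E p i j | _ \<Rightarrow> 0)" for x :: bezout_unknown
  \<comment> \<open>the summands of \<open>Y\<close> in this order: \<open>A F + B G = S\<close>, the normalisation, the order of \<open>A\<close>, the order of \<open>B\<close>\<close>
  define a where "a x y = (case y of
      Inl (i, j, k) \<Rightarrow> coeff3 (A' x * F + B' x * G - E' x) i j k
    | Inr (Inl (i, j, k)) \<Rightarrow> coeff3 (B' x) (i0 + i) (j0 + j) (k0 + k)
    | Inr (Inr (Inl (p, i, j))) \<Rightarrow> coeff (coeff (germ p (A' x)) j) i
    | Inr (Inr (Inr (p, i, j))) \<Rightarrow> coeff (coeff (germ p (B' x)) j) i)" for x y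
  have finJ: "finite J" unfolding J_def using fin finite_triangle by auto
  have finX: "finite X" unfolding X_def using finJ finite_exponents by auto
  have finY: "finite Y" unfolding Y_def using fin finite_exponents finite_triangle by auto
  have cX: "card X = card (triangle (Suc (N + e))) + card (triangle (Suc (N + d))) +
      (\<Sum>p\<in>P. card (triangle (r p)))"
    unfolding X_def using fin finJ finite_exponents finite_triangle
    by (simp add: card_Plus card_exponents J_def)
  have cY: "card Y = card (triangle (Suc t)) + card (triangle (Suc N)) +
      ((\<Sum>p\<in>P. card (triangle (n p))) + (\<Sum>p\<in>P. card (triangle (m p))))"
    unfolding Y_def using fin finite_exponents finite_triangle
    by (simp add: card_Plus card_exponents)
  have "card X + d * e = card Y + (\<Sum>p\<in>P. m p * n p)"
    unfolding cX cY r_def card_triangle_add sum.distrib t_def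
    using card_triangle_add[of "Suc N" e] card_triangle_add[of "Suc N" d]
      card_triangle_add[of "Suc N" "d + e"] card_triangle_add[of d e]
    by (simp add: algebra_simps)
  with large have "card Y < card X" by linarith
  from underdetermined_system[OF finY finX this, of a]
  obtain c x0 where c: "x0 \<in> X" "c x0 \<noteq> 0" "\<And>y. y \<in> Y \<Longrightarrow> (\<Sum>x\<in>X. c x * a x y) = 0" by blast
  define A where "A = (\<Sum>x\<in>X. const3 (c x) * A' x)"
  define B where "B = (\<Sum>x\<in>X. const3 (c x) * B' x)"
  define S where "S = (\<Sum>x\<in>X. const3 (c x) * E' x)"
  have T: "A * F + B * G - S = (\<Sum>x\<in>X. const3 (c x) * (A' x * F + B' x * G - E' x))"
    unfolding A_def B_def S_def
    by (simp add: sum_distrib_left sum_distrib_right sum.distrib sum_subtractf algebra_simps)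
  have mon: "form s (mon3 i j k)" if "(i, j, k) \<in> exponents s" for s i j k
    using that form_mon3 by (auto simp: exponents_def)
  have JE: "form t (E p i j)" if "(p, i, j) \<in> J" for p i j
    using that rM by (intro E(1)) (auto simp: J_def triangle_def intro: less_le_trans)
  have A_form: "form (N + e) A" and B_form: "form (N + d) B" and S_form: "form t S"
    unfolding A_def B_def S_def
    by (intro form_sum form_const3_mult;
        force simp: X_def A'_def B'_def E'_def form_0 mon JE split: sum.splits)+
  have T0: "A * F + B * G = S"
  proof -
    have "form t (A * F + B * G - S)"
      using form_mult[OF A_form F(2)] form_mult[OF B_form G(1)] S_form
      by (auto intro!: form_add form_diff simp: t_def add_ac)
    then have "coeff3 (A * F + B * G - S) i j k = 0" if "(i, j, k) \<notin> exponents t" for i j k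
      using that by (auto simp: form_def exponents_def)
    moreover have "coeff3 (A * F + B * G - S) i j k = 0" if "(i, j, k) \<in> exponents t" for i j k
      using c(3)[of "Inl (i, j, k)"] that unfolding T coeff3_linear_combination
      by (auto simp: Y_def a_def)
    ultimately have "A * F + B * G - S = 0" by (intro poly3_eqI) (metis coeff3_0)
    then show ?thesis by simp
  qed
  have A_van: "vanishes (n p) (germ p A)" and B_van: "vanishes (m p) (germ p B)" if p: "p \<in> P" for p
  proof -
    have "coeff (coeff (germ p A) j) i = 0" if "i + j < n p" for i j
      using c(3)[of "Inr (Inr (Inl (p, i, j)))"] p that
      unfolding A_def coeff_germ_linear_combination by (auto simp: Y_def a_def triangle_def)
    then show "vanishes (n p) (germ p A)" by (simp add: vanishes_def)
    have "coeff (coeff (germ p B) j) i = 0" if "i + j < m p" for i j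
      using c(3)[of "Inr (Inr (Inr (p, i, j)))"] p that
      unfolding B_def coeff_germ_linear_combination by (auto simp: Y_def a_def triangle_def)
    then show "vanishes (m p) (germ p B)" by (simp add: vanishes_def)
  qed
  have S_eq: "S = (\<Sum>(p, i, j)\<in>J. const3 (c (Inr (Inr (p, i, j)))) * E p i j)"
  proof -
    have "S = (\<Sum>x\<in>(Inr \<circ> Inr) ` J. const3 (c x) * E' x)"
      unfolding S_def using finX
      by (intro sum.mono_neutral_right) (auto simp: X_def E'_def split: sum.splits)
    also have "\<dots> = (\<Sum>x\<in>J. const3 (c (Inr (Inr x))) * E' (Inr (Inr x)))"
      by (subst sum.reindex) (auto intro: inj_onI)
    finally show ?thesis by (simp add: E'_def case_prod_unfold)
  qed
  have cE: "c (Inr (Inr (p, i, j))) = 0" if "(p, i, j) \<in> J" for p i j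
  proof (rule jet_forms_independent[OF fin E(2,3) u rM,
        where c = "\<lambda>p i j. c (Inr (Inr (p, i, j)))"])
    fix q assume q: "q \<in> P"
    have "vanishes (r q) (germ q (A * F + B * G))"
      using vanishes_mult[OF A_van[OF q] m[OF q]] vanishes_mult[OF B_van[OF q] n[OF q]]
      by (auto simp: germ_add germ_mult r_def add.commute intro: vanishes_add)
    then show "vanishes (r q) (germ q (\<Sum>(p, i, j)\<in>Sigma P (\<lambda>p. triangle (r p)).
        const3 (c (Inr (Inr (p, i, j)))) * E p i j))"
      unfolding T0 S_eq J_def .
  qed (use that in \<open>auto simp: J_def triangle_def\<close>)
  have "S = 0" unfolding S_eq by (rule sum.neutral) (auto simp: cE const3_def)
  with T0 have AB: "A * F + B * G = 0" by simp
  have "B = 0"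
  proof (rule ccontr)
    assume B0: "B \<noteq> 0"
    have "F dvd B * G" using AB by (metis add_eq_0_iff dvd_minus_iff dvd_triv_right)
    moreover have "prime_elem F" using F(1) by (rule irreducible_imp_prime_elem)
    ultimately have "F dvd B" using G(2) prime_elem_dvd_mult_iff by blast
    then obtain C where C: "B = F * C" by blast
    with B0 have C0: "C \<noteq> 0" by auto
    obtain i j k where ijk: "lead_exp C = (i, j, k)" by (cases "lead_exp C")
    have lB: "lead_exp B = (i0 + i, j0 + j, k0 + k)"
      unfolding C by (rule lead_exp_mult[OF F0 C0 lead ijk])
    note lB' = lead_exp_form[OF B_form B0 lB]
    have "i0 + j0 + k0 = d" using lead_exp_form[OF F(2) F0 lead] by simp
    with lB'(2) have "(i, j, k) \<in> exponents N" by (simp add: exponents_def)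
    then have "coeff3 B (i0 + i) (j0 + j) (k0 + k) = 0"
      using c(3)[of "Inr (Inl (i, j, k))"] unfolding B_def coeff3_linear_combination
      by (auto simp: Y_def a_def)
    with lB'(1) show False by simp
  qed
  with AB F0 have "A = 0" by simp
  have cA: "c (Inl (i, j, k)) = 0" if ijk: "(i, j, k) \<in> exponents (N + e)" for i j k
  proof -
    have "0 = coeff3 A i j k" using \<open>A = 0\<close> by (simp add: coeff3_0)
    also have "\<dots> = (\<Sum>x\<in>X. if x = Inl (i, j, k) then c x else 0)"
      unfolding A_def coeff3_linear_combination
      by (intro sum.cong) (auto simp: A'_def coeff3_mon3 coeff3_0 split: sum.splits)
    also have "\<dots> = c (Inl (i, j, k))" using ijk by (subst sum.delta[OF finX]) (auto simp: X_def)
    finally show ?thesis by simp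
  qed
  have cB: "c (Inr (Inl (i, j, k))) = 0" if ijk: "(i, j, k) \<in> exponents (N + d)" for i j k
  proof -
    have "0 = coeff3 B i j k" using \<open>B = 0\<close> by (simp add: coeff3_0)
    also have "\<dots> = (\<Sum>x\<in>X. if x = Inr (Inl (i, j, k)) then c x else 0)"
      unfolding B_def coeff3_linear_combination
      by (intro sum.cong) (auto simp: B'_def coeff3_mon3 coeff3_0 split: sum.splits)
    also have "\<dots> = c (Inr (Inl (i, j, k)))" using ijk by (subst sum.delta[OF finX]) (auto simp: X_def)
    finally show ?thesis by simp
  qed
  show False using c(1,2) cA cB cE unfolding X_def by (auto simp: J_def)
qed

section \<open>Partial derivatives and the Euler identity\<close>

text \<open>A derivation is determined by its values on constants and variables. This yields the chain rule
  below without expanding a polynomial into monomials.\<close>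

definition derivation :: "('a::comm_ring_1 \<Rightarrow> 'a) \<Rightarrow> bool" where
  "derivation D \<longleftrightarrow> (\<forall>a b. D (a + b) = D a + D b) \<and> (\<forall>a b. D (a * b) = D a * b + a * D b)"

lemma derivation_add: "derivation D \<Longrightarrow> D (a + b) = D a + D b"
  and derivation_mult: "derivation D \<Longrightarrow> D (a * b) = D a * b + a * D b"
  by (auto simp: derivation_def)

lemma derivation_0: "derivation D \<Longrightarrow> D 0 = 0"
  using derivation_add[of D 0 0] by simp

lemma derivation_pderiv: "derivation (pderiv :: 'a::idom poly \<Rightarrow> 'a poly)"
  by (simp add: derivation_def pderiv_add pderiv_mult algebra_simps)

lemma derivation_map_poly:
  assumes "derivation (D :: 'a::idom \<Rightarrow> 'a)"
  shows "derivation (map_poly D)"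
proof -
  note D = derivation_0[OF assms] derivation_add[OF assms] derivation_mult[OF assms]
  have add: "map_poly D (f + g) = map_poly D f + map_poly D g" for f g
    by (intro poly_eqI) (simp add: coeff_map_poly D)
  have smult: "map_poly D (smult a g) = smult (D a) g + smult a (map_poly D g)" for a g
    by (intro poly_eqI) (simp add: coeff_map_poly D)
  have pC: "map_poly D (pCons a f) = pCons (D a) (map_poly D f)" for a f
    by (intro poly_eqI) (simp add: coeff_map_poly D coeff_pCons split: nat.splits)
  have "map_poly D (f * g) = map_poly D f * g + f * map_poly D g" for f g
    by (induction f) (simp_all add: pC add smult D)
  with add show ?thesis by (simp add: derivation_def)
qed

definition partial :: "3 \<Rightarrow> poly3 \<Rightarrow> poly3" where
  "partial j = (if j = 1 then map_poly (map_poly pderiv) else if j = 2 then map_poly pderiv else pderiv)"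

lemma derivation_partial: "derivation (partial j)"
  by (simp add: partial_def derivation_map_poly derivation_pderiv)

lemma partial_const3: "partial j (const3 c) = 0"
  by (simp add: partial_def const3_def map_poly_pCons pderiv_pCons)

lemma partial_var3: "partial j (var3 i) = (if i = j then 1 else 0)"
  using exhaust_3[of i] exhaust_3[of j]
  by (auto simp: partial_def var3_def map_poly_pCons pderiv_pCons one_pCons)

text \<open>The polynomial ring is generated by its constants and variables.\<close>

lemma poly3_induct [case_names const3 var3 add mult]:
  assumes "\<And>c. Q (const3 c)" "\<And>j. Q (var3 j)"
    and "\<And>F G. Q F \<Longrightarrow> Q G \<Longrightarrow> Q (F + G)" "\<And>F G. Q F \<Longrightarrow> Q G \<Longrightarrow> Q (F * G)"
  shows "Q F"
proof -
  have 1: "Q [:[:f:]:]" for f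
  proof (induction f)
    case 0
    show ?case using assms(1)[of 0] by (simp add: const3_def)
  next
    case (pCons a f)
    have "[:[:pCons a f:]:] = const3 a + var3 1 * [:[:f:]:]" by (simp add: const3_def var3_def)
    with assms pCons show ?case by metis
  qed
  have 2: "Q [:g:]" for g
  proof (induction g)
    case 0
    show ?case using 1[of 0] by simp
  next
    case (pCons a g)
    have "[:pCons a g:] = [:[:a:]:] + var3 2 * [:g:]" by (simp add: var3_def)
    with assms 1 pCons show ?case by metis
  qed
  show ?thesis
  proof (induction F)
    case 0
    show ?case using 2[of 0] by simp
  next
    case (pCons a F)
    have "pCons a F = [:a:] + var3 3 * F" by (simp add: var3_def)
    with assms 2 pCons show ?case by metis
  qed
qed

lemma derivation_germ:
  assumes D: "derivation D" "\<And>c. D [:[:c:]:] = 0"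
    and var: "\<And>j. D (germ p (var3 j)) = (if j = i then 1 else 0)"
  shows "D (germ p F) = germ p (partial i F)"
proof (induction F rule: poly3_induct)
  case (const3 c)
  show ?case by (simp add: germ_const3 D partial_const3 germ_0)
next
  case (var3 j)
  show ?case by (simp add: var partial_var3 germ_0 germ_1)
next
  case (add F G)
  then show ?case by (simp add: germ_add derivation_add[OF D(1)] derivation_add[OF derivation_partial])
next
  case (mult F G)
  then show ?case
    by (simp add: germ_mult germ_add derivation_mult[OF D(1)] derivation_mult[OF derivation_partial])
qed

text \<open>The chain rule. In the chart of \<open>p\<close> the chart coordinate is constant and the other two are translated, so
  two of the three partial derivatives become those of the local equation.\<close>

lemma germ_partial:
  "germ p (partial (chart p + 1) F) = map_poly pderiv (germ p F)"
  "germ p (partial (chart p + 2) F) = pderiv (germ p F)"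
proof -
  have "derivation (map_poly pderiv :: complex poly poly \<Rightarrow> complex poly poly)"
    by (intro derivation_map_poly derivation_pderiv)
  moreover have "map_poly pderiv (germ p (var3 j)) = (if j = chart p + 1 then 1 else 0)" for j
    using chart_neq[of "chart p"] by (auto simp: germ_var3 map_poly_pCons pderiv_pCons one_pCons)
  ultimately show "germ p (partial (chart p + 1) F) = map_poly pderiv (germ p F)"
    by (intro derivation_germ[symmetric]) (auto simp: map_poly_pCons pderiv_pCons)
  have "pderiv (germ p (var3 j)) = (if j = chart p + 2 then 1 else 0)" for j
    using chart_neq[of "chart p"] by (auto simp: germ_var3 pderiv_pCons one_pCons)
  then show "germ p (partial (chart p + 2) F) = pderiv (germ p F)"
    by (intro derivation_germ[symmetric] derivation_pderiv) (auto simp: pderiv_pCons)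
qed

lemma coeff3_partial:
  "coeff3 (partial 1 F) i j k = of_nat (Suc i) * coeff3 F (Suc i) j k"
  "coeff3 (partial 2 F) i j k = of_nat (Suc j) * coeff3 F i (Suc j) k"
  "coeff3 (partial 3 F) i j k = of_nat (Suc k) * coeff3 F i j (Suc k)"
proof -
  have of_nat: "coeff (of_nat n * f) m = of_nat n * coeff f m" for n m and f :: "'a::comm_ring_1 poly"
    by (simp add: of_nat_poly)
  show "coeff3 (partial 1 F) i j k = of_nat (Suc i) * coeff3 F (Suc i) j k"
    "coeff3 (partial 2 F) i j k = of_nat (Suc j) * coeff3 F i (Suc j) k"
    "coeff3 (partial 3 F) i j k = of_nat (Suc k) * coeff3 F i j (Suc k)"
    by (simp_all add: partial_def coeff3_def coeff_map_poly coeff_pderiv of_nat del: of_nat_Suc)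
qed

lemma form_partial:
  assumes "form d F"
  shows "form (d - 1) (partial j F)"
  unfolding form_def
proof (intro allI impI)
  fix a b c assume "coeff3 (partial j F) a b c \<noteq> 0"
  then have "coeff3 F (Suc a) b c \<noteq> 0 \<or> coeff3 F a (Suc b) c \<noteq> 0 \<or> coeff3 F a b (Suc c) \<noteq> 0"
    using exhaust_3[of j] by (auto simp: coeff3_partial simp del: of_nat_Suc)
  moreover have *: "coeff3 F i j k \<noteq> 0 \<Longrightarrow> i + j + k = d" for i j k
    using assms by (simp add: form_def)
  ultimately have "Suc (a + b + c) = d"
    using *[of "Suc a" b c] *[of a "Suc b" c] *[of a b "Suc c"] by auto
  then show "a + b + c = d - 1" by simp
qed

lemma euler_identity:
  assumes "form d F"
  shows "const3 (of_nat d) * F = (\<Sum>j\<in>UNIV. var3 j * partial j F)"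
proof (rule poly3_eqI)
  fix i j k
  have "coeff3 (var3 1 * partial 1 F) i j k = of_nat i * coeff3 F i j k"
    "coeff3 (var3 2 * partial 2 F) i j k = of_nat j * coeff3 F i j k"
    "coeff3 (var3 3 * partial 3 F) i j k = of_nat k * coeff3 F i j k"
    using coeff3_partial[of F]
    by (auto simp: coeff3_def var3_def coeff_pCons split: nat.splits)
  then show "coeff3 (const3 (of_nat d) * F) i j k = coeff3 (\<Sum>j\<in>UNIV. var3 j * partial j F) i j k"
    using assms by (cases "coeff3 F i j k = 0")
      (auto simp: coeff3_const3_mult sum_3 coeff3_add form_def simp flip: of_nat_add distrib_right)
qed

lemma vanishes_pderiv:
  assumes "vanishes m f"
  shows "vanishes (m - 1) (map_poly pderiv f)" "vanishes (m - 1) (pderiv f)"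
proof -
  have of_nat: "coeff (of_nat n * f) m = of_nat n * coeff f m" for n m and f :: "complex poly"
    by (simp add: of_nat_poly)
  show "vanishes (m - 1) (map_poly pderiv f)" "vanishes (m - 1) (pderiv f)"
    using assms
    by (simp_all add: vanishes_def coeff_map_poly coeff_pderiv of_nat less_diff_conv del: of_nat_Suc)
qed

text \<open>The derivative in the direction of the chart coordinate has no counterpart in the affine chart; the Euler
  identity expresses it through the form and its other two derivatives.\<close>

lemma vanishes_germ_partial:
  assumes F: "form d F" "vanishes m (germ p F)"
  shows "vanishes (m - 1) (germ p (partial j F))"
proof -
  let ?c = "chart p"
  have 1: "vanishes (m - 1) (germ p (partial (?c + 1) F))"
    and 2: "vanishes (m - 1) (germ p (partial (?c + 2) F))"
    unfolding germ_partial by (rule vanishes_pderiv[OF F(2)])+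
  have four: "(4 :: 3) = 1" and five: "(5 :: 3) = 2" by simp_all
  have "const3 (of_nat d) * F = var3 ?c * partial ?c F +
      (var3 (?c + 1) * partial (?c + 1) F + var3 (?c + 2) * partial (?c + 2) F)"
    unfolding euler_identity[OF F(1)] sum_3 using exhaust_3[of ?c] by (auto simp: add_ac four five)
  from arg_cong[OF this, of "germ p"]
  have "germ p (partial ?c F) = germ p (const3 (of_nat d)) * germ p F -
      (germ p (var3 (?c + 1)) * germ p (partial (?c + 1) F) +
       germ p (var3 (?c + 2)) * germ p (partial (?c + 2) F))"
    by (simp add: germ_add germ_mult germ_var3_chart)
  moreover have "vanishes (m - 1) (germ p F)" using F(2) by (rule vanishes_mono) simp
  ultimately have "vanishes (m - 1) (germ p (partial ?c F))"
    using 1 2 by (auto intro: vanishes_diff vanishes_add vanishes_mult_left)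
  moreover have "j = ?c \<or> j = ?c + 1 \<or> j = ?c + 2" using exhaust_3[of j] exhaust_3[of ?c] by auto
  ultimately show ?thesis using 1 2 by auto
qed

section \<open>Multiplicities of an irreducible curve and the Seshadri constant\<close>

lemma irreducible_form_degree_pos:
  assumes "irreducible F" "form d F"
  shows "d > 0"
proof (rule ccontr)
  assume "\<not> d > 0"
  then have F: "F = const3 (coeff3 F 0 0 0)"
    using assms(2)
    by (intro poly3_eqI) (auto simp: form_def coeff3_def const3_def coeff_pCons split: nat.splits)
  have "F \<noteq> 0" using assms(1) by auto
  with F have "coeff3 F 0 0 0 \<noteq> 0" by (metis const3_def pCons_0_0)
  then have "is_unit (const3 (coeff3 F 0 0 0))"
    by (simp add: const3_def is_unit_const_poly_iff dvd_field_iff)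
  with F have "is_unit F" by simp
  with assms(1) show False using irreducible_not_unit by blast
qed

text \<open>The Bezout inequality for the curve and a polar. Since the characteristic is 0, the Euler identity
  makes some partial derivative nonzero; its degree is too small for a multiple of \<open>F\<close>.\<close>

lemma sum_mult_pred_le:
  assumes "finite P" "irreducible F" "form d F" and m: "\<And>p. p \<in> P \<Longrightarrow> vanishes (m p) (germ p F)"
  shows "(\<Sum>p\<in>P. m p * (m p - 1)) \<le> d * (d - 1)"
proof -
  have d: "d > 0" by (rule irreducible_form_degree_pos[OF assms(2,3)])
  have F0: "F \<noteq> 0" using assms by auto
  have "const3 (of_nat d) * F \<noteq> 0" using d F0 by (simp add: const3_def)
  then have "\<not> (\<forall>j. partial j F = 0)" unfolding euler_identity[OF assms(3)]
    using sum.neutral[of UNIV "\<lambda>j. var3 j * partial j F"] by auto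
  then obtain j where j: "partial j F \<noteq> 0" by blast
  have "\<not> F dvd partial j F"
  proof
    assume "F dvd partial j F"
    then obtain C where C: "partial j F = F * C" by blast
    with j have C0: "C \<noteq> 0" by auto
    obtain i0 j0 k0 where lF: "lead_exp F = (i0, j0, k0)" by (cases "lead_exp F")
    obtain i1 j1 k1 where lC: "lead_exp C = (i1, j1, k1)" by (cases "lead_exp C")
    have lead: "lead_exp (partial j F) = (i0 + i1, j0 + j1, k0 + k1)"
      unfolding C by (rule lead_exp_mult[OF F0 C0 lF lC])
    have "i0 + j0 + k0 = d" using lead_exp_form[OF assms(3) F0 lF] by simp
    moreover have "(i0 + i1) + (j0 + j1) + (k0 + k1) = d - 1"
      by (rule lead_exp_form(2)[OF form_partial[OF assms(3)] j lead])
    ultimately show False using d by linarith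
  qed
  then show ?thesis
    using m vanishes_germ_partial[OF assms(3) m]
    by (rule sum_mult_le_prod_degrees[OF assms(1-3) form_partial[OF assms(3)]])
qed

lemma form_total_degree: "homogeneous F \<Longrightarrow> form (total_degree F) F"
  by (simp add: homogeneous_def form_def)

theorem mainTheorem4:
  fixes P :: "proj_plane set" and s :: nat
  assumes "finite P" and "card P = s" and "s \<ge> 1"
    and "\<exists>F. computes_seshadri F P \<and> (\<forall>p\<in>P. mult_at p F > 1)"
  shows "seshadri P > sqrt (1 / (2 * real s))"
proof -
  obtain F where F: "computes_seshadri F P" and m2: "\<And>p. p \<in> P \<Longrightarrow> mult_at p F > 1"
    using assms(4) by blast
  define d where "d = total_degree F"
  define m where "m p = mult_at p F" for p
  have irr: "irreducible F" and form: "form d F" and eps: "seshadri P = real d / real (\<Sum>p\<in>P. m p)"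
    using F form_total_degree
    by (auto simp: computes_seshadri_def curves_meeting_def integral_curve_def d_def m_def
        seshadri_quotient_def)
  have d: "d > 0" by (rule irreducible_form_degree_pos[OF irr form])
  define M where "M = (\<Sum>p\<in>P. real (m p))"
  have "P \<noteq> {}" using assms by auto
  then have M0: "M > 0" unfolding M_def using assms(1) m2 by (intro sum_pos) (fastforce simp: m_def dest: m2)+
  have "M\<^sup>2 \<le> (\<Sum>p\<in>P. (real (m p))\<^sup>2) * card P"
    unfolding M_def by (rule sum_squared_le_sum_of_squares)
  also have "(\<Sum>p\<in>P. (real (m p))\<^sup>2) \<le> 2 * (\<Sum>p\<in>P. real (m p * (m p - 1)))"
    unfolding sum_distrib_left
  proof (rule sum_mono)
    fix p assume "p \<in> P"
    then have "m p \<ge> 2" using m2 by (force simp: m_def)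
    then have "m p * m p \<le> 2 * (m p * (m p - 1))" by (cases "m p") auto
    then have "real (m p * m p) \<le> real (2 * (m p * (m p - 1)))" by (rule of_nat_mono)
    then show "(real (m p))\<^sup>2 \<le> 2 * real (m p * (m p - 1))"
      by (simp only: power2_eq_square of_nat_mult of_nat_numeral)
  qed
  also have "(\<Sum>p\<in>P. real (m p * (m p - 1))) \<le> real (d * (d - 1))"
    unfolding of_nat_sum[symmetric] of_nat_le_iff
    by (intro sum_mult_pred_le[OF assms(1) irr form]) (simp add: m_def vanishes_mult_at)
  also have "real (d * (d - 1)) < (real d)\<^sup>2"
    using d by (simp add: power2_eq_square)
  finally have "M\<^sup>2 < 2 * (real d)\<^sup>2 * s" using assms(2,3) by simp
  then have "1 / (2 * real s) < (real d / M)\<^sup>2"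
    using M0 assms(3) by (simp add: power_divide field_simps)
  then have "sqrt (1 / (2 * real s)) < real d / M"
    using M0 by (intro real_less_lsqrt) auto
  then show ?thesis by (simp add: eps M_def)
qed

end
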